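(* Let $m\ge 1$ and let $G=(N,E)$ be a finite directed graph whose edges are labeled by nonempty finite words over $\{1,\dots,m\}$. The set of ellipsoidal Lyapunov inequalities represented by $G$ is a sufficient condition for stability if and only if $G$ is path-complete.
   Context: Words and products. For a word $w=w_1\cdots w_t$ over $\{1,\dots,m\}$ and square matrices $A_1,\dots,A_m$ of the same size, $A_w=A_{w_1}A_{w_2}\cdots A_{w_t}$. The mirror of $w$ is $\bar w=w_t\cdots w_1$. A word $u$ is a subword of a word $v$ if it appears in $v$ as a block of consecutive letters. Stability. A finite set $\Sigma=\{A_1,\dots,A_m\}\subset\mathbb{R}^{n\times n}$ is stable if for every switching signal $\sigma:\mathbb{N}\to\{1,\dots,m\}$ and every initial vector $x_0\in\mathbb{R}^n$, the trajectory $x_{k+1}=A_{\sigma(k)}x_k$ tends to $0$. Equivalently, the joint spectral radius $\rho(\Sigma)=\lim_{k\to\infty}\max_{\sigma\in\{1,\dots,m\}^k}\|A_{\sigma_k}\cdots A_{\sigma_1}\|^{1/k}$ is $<1$. Ellipsoidal Lyapunov inequalities and their graph. Each node $i\in N$ stands for an unknown quadratic form $x^TP_ix$ with $P_i$ symmetric positive definite, and each edge from node $i$ to node $j$ with label $\bar w$ stands for the linear matrix inequality $A_w^TP_jA_w\prec P_i$ (that is, $P_i-A_w^TP_jA_w$ is positive definite). A set $\Sigma=\{A_1,\dots,A_m\}\subset\mathbb{R}^{n\times n}$ satisfies the ellipsoidal Lyapunov inequalities represented by $G$ if there exist symmetric matrices $P_i\succ0$ in $\mathbb{R}^{n\times n}$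 ($i\in N$) such that $A_w^TP_jA_w\prec P_i$ for every edge from $i$ to $j$ with label $\bar w$. The set of inequalities is a sufficient condition for stability if, for every $n\ge1$, every set $\Sigma=\{A_1,\dots,A_m\}\subset\mathbb{R}^{n\times n}$ satisfying them is stable. Path-completeness. $G$ is path-complete if for every finite word $u$ over $\{1,\dots,m\}$ there is a directed path in $G$ such that the word obtained by concatenating the labels of the edges along the path contains $u$ as a subword. *)

theory Defs
  imports
    Complex_Main
    "HOL-Library.Sublist"
    "Graph_Theory.Arc_Walk"
    "Jordan_Normal_Form.Matrix"
begin

text \<open>
  The dimension \<open>n\<close> is quantified inside the main property
  \<open>sufficient_for_stability\<close>, so matrices and vectors are taken from the carriers
  \<open>carrier_mat n n\<close> and \<open>carrier_vec n\<close> instead of using types indexed by dimension.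
  A set \<open>{A\<^sub>1, \<dots>, A\<^sub>m}\<close> of matrices is a family \<open>A :: nat \<Rightarrow> real mat\<close>; only its values
  on \<open>{1..m}\<close> matter, and repetitions are allowed.  Words are lists of letters.
\<close>

definition pos_def_mat :: "nat \<Rightarrow> real mat \<Rightarrow> bool" where
  "pos_def_mat n P \<longleftrightarrow> P \<in> carrier_mat n n \<and> P\<^sup>T = P
     \<and> (\<forall>x \<in> carrier_vec n. x \<noteq> 0\<^sub>v n \<longrightarrow> x \<bullet> (P *\<^sub>v x) > 0)"

definition word_mat :: "nat \<Rightarrow> (nat \<Rightarrow> real mat) \<Rightarrow> nat list \<Rightarrow> real mat" where
  "word_mat n A w = foldr (\<lambda>a M. A a * M) w (1\<^sub>m n)"

primrec trajectory :: "(nat \<Rightarrow> real mat) \<Rightarrow> (nat \<Rightarrow> nat) \<Rightarrow> real vec \<Rightarrow> nat \<Rightarrow> real vec" where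
  "trajectory A \<sigma> x0 0 = x0"
| "trajectory A \<sigma> x0 (Suc k) = A (\<sigma> k) *\<^sub>v trajectory A \<sigma> x0 k"

text \<open>Convergence of the trajectory is convergence to zero of its Euclidean norm.\<close>

definition stable_set :: "nat \<Rightarrow> nat \<Rightarrow> (nat \<Rightarrow> real mat) \<Rightarrow> bool" where
  "stable_set m n A \<longleftrightarrow>
     (\<forall>\<sigma>. (\<forall>k. \<sigma> k \<in> {1..m}) \<longrightarrow>
       (\<forall>x0 \<in> carrier_vec n.
         (\<lambda>k. sqrt (trajectory A \<sigma> x0 k \<bullet> trajectory A \<sigma> x0 k)) \<longlonglongrightarrow> 0))"

text \<open>
  An arc from \<open>i\<close> to \<open>j\<close> whose label is the mirror of \<open>w\<close> stands for \<open>A\<^sub>w\<^sup>T P\<^sub>j A\<^sub>w \<prec> P\<^sub>i\<close>;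
  hence \<open>w\<close> is the reversal of the label.
\<close>

definition satisfies_ellipsoidal_inequalities ::
  "('v, 'e) pre_digraph \<Rightarrow> ('e \<Rightarrow> nat list) \<Rightarrow> nat \<Rightarrow> (nat \<Rightarrow> real mat) \<Rightarrow> bool" where
  "satisfies_ellipsoidal_inequalities G label n A \<longleftrightarrow>
     (\<exists>P :: 'v \<Rightarrow> real mat.
       (\<forall>i \<in> verts G. pos_def_mat n (P i)) \<and>
       (\<forall>e \<in> arcs G.
         let Aw = word_mat n A (rev (label e))
         in pos_def_mat n (P (tail G e) - Aw\<^sup>T * P (head G e) * Aw)))"

definition sufficient_for_stability ::
  "nat \<Rightarrow> ('v, 'e) pre_digraph \<Rightarrow> ('e \<Rightarrow> nat list) \<Rightarrow> bool" where
  "sufficient_for_stability m G label \<longleftrightarrow>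
     (\<forall>n \<ge> 1. \<forall>A :: nat \<Rightarrow> real mat.
        (\<forall>a \<in> {1..m}. A a \<in> carrier_mat n n) \<longrightarrow>
        satisfies_ellipsoidal_inequalities G label n A \<longrightarrow> stable_set m n A)"

text \<open>
  The directed path may revisit vertices and arcs, and
  \<open>sublist\<close> is the relation of being a block of consecutive letters.
\<close>

definition path_complete ::
  "nat \<Rightarrow> ('v, 'e) pre_digraph \<Rightarrow> ('e \<Rightarrow> nat list) \<Rightarrow> bool" where
  "path_complete m G label \<longleftrightarrow>
     (\<forall>u \<in> lists {1..m}. \<exists>i p j.
        pre_digraph.awalk G i p j \<and> sublist u (concat (map label p)))"

end

theory Submission
  imports
    "HOL-Analysis.Function_Topology"
    "HOL-Number_Theory.Cong"
    Defs
begin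

text \<open>
  Write \<open>V\<^sub>i x\<close> for the quadratic form \<open>x \<bullet> P\<^sub>i x\<close>. Read forward in time, an arc from \<open>i\<close> to \<open>j\<close>
  says that, from every nonzero state, \<open>V\<^sub>j\<close> after applying the letters of its label is smaller than
  \<open>V\<^sub>i\<close> before.

  A path-complete graph gives stability because the decrease is uniform. On the unit sphere,
  which is compact, a positive definite form dominates a positive multiple of any other form
  (\<open>pos_def_family_dominates\<close>). As there are finitely many arcs, one factor \<open>\<gamma> < 1\<close> bounds the
  decrease along all of them, so a walk with \<open>k\<close> arcs contracts by \<open>\<gamma> ^ k\<close>. Every finite initial
  part of a switching signal occurs inside the label of a walk, and inside it at most a piece of
  an arc label is left over at each end (\<open>sublist_concat_map\<close>). These two pieces have bounded length
  and hence a bounded effect, while the number of complete arcs between them grows linearly with the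
  length of the word. As the forms are equivalent to the squared norm, the state tends to zero.

  Conversely, let \<open>w\<close> be a nonempty word of length \<open>n\<close> that no walk contains. Put the letters of \<open>w\<close>
  on a cycle with \<open>n\<close> positions and let the matrix of a letter \<open>a\<close> move the \<open>k\<close>-th unit vector
  to the next position if the letter at \<open>k\<close> is \<open>a\<close>, and to \<open>0\<close> otherwise. The periodic signal \<open>www\<dots>\<close>
  moves the first unit vector around the cycle for ever, so the set is not stable
  (\<open>not_stable_cyc_shift\<close>). Any word of length \<open>2 n\<close> that can be read along the cycle
  contains \<open>w\<close> (\<open>cyc_reads_sublist\<close>), so a walk whose label can be read has fewer than \<open>2 n\<close> arcs.
  Let \<open>d i k\<close> be one plus the largest number of arcs of a walk from \<open>i\<close> that can be read from
  position \<open>k\<close>. Traversing an arc that can be read strictly decreases this number. As the numbers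
  are positive, this means that the diagonal matrices with the entries \<open>d i 0, \<dots>, d i (n - 1)\<close>
  solve the Lyapunov inequalities (\<open>unread_word_refutes_sufficiency\<close>).
\<close>

section \<open>Quadratic forms\<close>

abbreviation quad_form :: "real mat \<Rightarrow> real vec \<Rightarrow> real" where
  "quad_form P x \<equiv> x \<bullet> (P *\<^sub>v x)"

lemma quad_form_vec:
  assumes "P \<in> carrier_mat n n"
  shows "quad_form P (vec n f) = (\<Sum>i<n. f i * (\<Sum>j<n. P $$ (i, j) * f j))"
  using assms by (auto simp: scalar_prod_def lessThan_atLeast0 intro!: sum.cong)

lemma quad_form_smult:
  assumes "P \<in> carrier_mat n n" "x \<in> carrier_vec n"
  shows "quad_form P (c \<cdot>\<^sub>v x) = c\<^sup>2 * quad_form P x"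
proof -
  have "P *\<^sub>v (c \<cdot>\<^sub>v x) = c \<cdot>\<^sub>v (P *\<^sub>v x)"
    using assms by (rule mult_mat_vec)
  then show ?thesis
    using assms by (simp add: power2_eq_square)
qed

lemma quad_form_one: "x \<in> carrier_vec n \<Longrightarrow> quad_form (1\<^sub>m n) x = x \<bullet> x"
  by simp

lemma congruence_carrier:
  fixes P A :: "real mat"
  assumes "P \<in> carrier_mat n n" "A \<in> carrier_mat n n"
  shows "A\<^sup>T * P * A \<in> carrier_mat n n"
  using assms by (meson mult_carrier_mat transpose_carrier_mat)

text \<open>
  This turns the matrix inequality of an arc into an inequality between the value of one form
  before, and of another form after, a linear map.
\<close>
lemma quad_form_congruence:
  assumes "P \<in> carrier_mat n n" "A \<in> carrier_mat n n" "x \<in> carrier_vec n"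
  shows "quad_form (A\<^sup>T * P * A) x = quad_form P (A *\<^sub>v x)"
proof -
  define y where "y = A *\<^sub>v x"
  have y: "y \<in> carrier_vec n" using assms(2,3) by (simp add: y_def)
  have Py: "P *\<^sub>v y \<in> carrier_vec n" using assms(1) y by simp
  have At: "A\<^sup>T \<in> carrier_mat n n" using assms(2) by simp
  have "(A\<^sup>T * P * A) *\<^sub>v x = (A\<^sup>T * P) *\<^sub>v y"
    unfolding y_def by (rule assoc_mult_mat_vec[OF mult_carrier_mat[OF At assms(1)] assms(2,3)])
  also have "\<dots> = A\<^sup>T *\<^sub>v (P *\<^sub>v y)"
    by (rule assoc_mult_mat_vec[OF At assms(1) y])
  finally have "quad_form (A\<^sup>T * P * A) x = x \<bullet> (A\<^sup>T *\<^sub>v (P *\<^sub>v y))" by simp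
  also have "\<dots> = (A\<^sup>T *\<^sub>v (P *\<^sub>v y)) \<bullet> x"
    using At Py assms(3) by (intro comm_scalar_prod[of _ n]) auto
  also have "\<dots> = (P *\<^sub>v y) \<bullet> y"
    using transpose_vec_mult_scalar[OF assms(2,3) Py]
    by (simp add: y_def)
  also have "\<dots> = quad_form P y"
    by (rule comm_scalar_prod[OF Py y])
  finally show ?thesis by (simp add: y_def)
qed

lemma quad_form_diff:
  assumes "P \<in> carrier_mat n n" "R \<in> carrier_mat n n" "x \<in> carrier_vec n"
  shows "quad_form (P - R) x = quad_form P x - quad_form R x"
  using assms by (simp add: minus_mult_distrib_mat_vec[of P n n R x]
      scalar_prod_minus_distrib[of x n "P *\<^sub>v x" "R *\<^sub>v x"])

lemma pos_def_quad_form_nonneg: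
  assumes "pos_def_mat n P" "x \<in> carrier_vec n"
  shows "quad_form P x \<ge> 0"
  using assms unfolding pos_def_mat_def
  by (cases "x = 0\<^sub>v n") (auto simp: less_imp_le)

lemma scalar_prod_self_pos:
  fixes x :: "real vec"
  assumes "x \<in> carrier_vec n" "x \<noteq> 0\<^sub>v n"
  shows "x \<bullet> x > 0"
proof -
  obtain i where i: "i < n" "x $ i \<noteq> 0"
    using assms by (metis carrier_vecD eq_vecI index_zero_vec(1,2))
  have "0 < (\<Sum>j = 0..<n. x $ j * x $ j)"
    using i by (intro sum_pos2[of _ i]) (auto simp: zero_less_mult_iff)
  then show ?thesis using assms by (simp add: scalar_prod_def)
qed

lemma scalar_prod_self_nonneg: "(x :: real vec) \<bullet> x \<ge> 0"
  by (auto simp: scalar_prod_def intro: sum_nonneg)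

lemma pos_def_one_mat: "pos_def_mat n (1\<^sub>m n)"
  by (simp add: pos_def_mat_def scalar_prod_self_pos)

text \<open>
  The dimension is a term and not a type, so the sphere is placed in the product space of all real
  sequences, where it is a closed subset of a product of compact intervals.
\<close>
lemma compact_coordinate_sphere:
  "compact {f :: nat \<Rightarrow> real. (\<forall>i\<ge>n. f i = 0) \<and> (\<Sum>i<n. (f i)\<^sup>2) = 1}"
proof -
  define B :: "(nat \<Rightarrow> real) set"
    where "B = PiE UNIV (\<lambda>i. if i < n then {-1..1} else {0})"
  have "compactin (product_topology (\<lambda>i::nat. euclidean :: real topology) UNIV) B"
    unfolding B_def by (subst compactin_PiE) auto
  then have "compact B"
    by (simp add: euclidean_product_topology)
  moreover have "closed {f :: nat \<Rightarrow> real. (\<Sum>i<n. (f i)\<^sup>2) = 1}"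
    by (intro closed_Collect_eq continuous_intros continuous_on_product_coordinates)
  ultimately have "compact (B \<inter> {f. (\<Sum>i<n. (f i)\<^sup>2) = 1})"
    by (rule compact_Int_closed)
  moreover have "\<bar>f i\<bar> \<le> 1" if "(\<Sum>i<n. (f i)\<^sup>2) = 1" "i < n" for f :: "nat \<Rightarrow> real" and i
  proof -
    have "(f i)\<^sup>2 \<le> (\<Sum>i<n. (f i)\<^sup>2)"
      using that(2) by (intro member_le_sum) auto
    then show ?thesis using that(1) by (simp add: abs_square_le_1)
  qed
  then have "B \<inter> {f. (\<Sum>i<n. (f i)\<^sup>2) = 1} = {f. (\<forall>i\<ge>n. f i = 0) \<and> (\<Sum>i<n. (f i)\<^sup>2) = 1}"
    unfolding B_def by (fastforce simp: PiE_def Pi_def abs_le_iff split: if_splits)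
  ultimately show ?thesis by simp
qed

text \<open>
  On the compact unit sphere the form of \<open>Q\<close> has a positive lower bound \<open>a\<close> and that of \<open>R\<close> has an
  upper bound \<open>b\<close>. As both forms are homogeneous of degree two, \<open>c = a / b\<close> works everywhere.
\<close>
lemma pos_def_dominates:
  assumes Q: "pos_def_mat n Q" and R: "R \<in> carrier_mat n n"
  obtains c where "c > 0" "\<And>x. x \<in> carrier_vec n \<Longrightarrow> c * quad_form R x \<le> quad_form Q x"
proof -
  define K :: "(nat \<Rightarrow> real) set" where "K = {f. (\<forall>i\<ge>n. f i = 0) \<and> (\<Sum>i<n. (f i)\<^sup>2) = 1}"
  have comp: "compact K" unfolding K_def by (rule compact_coordinate_sphere)
  have Qc: "Q \<in> carrier_mat n n" using Q by (simp add: pos_def_mat_def)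
  have cont: "continuous_on K (\<lambda>f. quad_form M (vec n f))" if "M \<in> carrier_mat n n" for M
    unfolding quad_form_vec[OF that]
    by (intro continuous_intros continuous_on_subset[OF continuous_on_product_coordinates]) auto
  have pos: "quad_form Q (vec n f) > 0" if "f \<in> K" for f
  proof -
    have "\<exists>i<n. f i \<noteq> 0" using that by (auto simp: K_def intro: ccontr)
    then have "vec n f \<noteq> 0\<^sub>v n" by (metis index_vec index_zero_vec(1))
    then show ?thesis using Q by (simp add: pos_def_mat_def)
  qed
  (* The sphere is empty in dimension 0, so an extremum need not exist. *)
  obtain a where a: "a > 0" "\<And>f. f \<in> K \<Longrightarrow> a \<le> quad_form Q (vec n f)"
  proof (cases "K = {}")
    case True
    show ?thesis by (rule that[of 1]) (use True in auto)
  next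
    case False
    obtain g where "g \<in> K" "\<forall>f\<in>K. quad_form Q (vec n g) \<le> quad_form Q (vec n f)"
      using continuous_attains_inf[OF comp False cont[OF Qc]] by blast
    then show ?thesis using that pos by blast
  qed
  obtain b where b: "b > 0" "\<And>f. f \<in> K \<Longrightarrow> quad_form R (vec n f) \<le> b"
  proof (cases "K = {}")
    case True
    show ?thesis by (rule that[of 1]) (use True in auto)
  next
    case False
    obtain g where "\<forall>f\<in>K. quad_form R (vec n f) \<le> quad_form R (vec n g)"
      using continuous_attains_sup[OF comp False cont[OF R]] by blast
    then show ?thesis using that[of "max 1 (quad_form R (vec n g))"] by fastforce
  qed
  have "a / b * quad_form R x \<le> quad_form Q x" if x: "x \<in> carrier_vec n" for x
  proof (cases "x = 0\<^sub>v n")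
    case True
    then show ?thesis using R Qc by simp
  next
    case False
    define r where "r = sqrt (x \<bullet> x)"
    have r: "r > 0" "r\<^sup>2 = x \<bullet> x"
      using scalar_prod_self_pos[OF x False] by (auto simp: r_def)
    define f where "f = (\<lambda>i. if i < n then x $ i / r else 0)"
    have "(\<Sum>i<n. (f i)\<^sup>2) = (\<Sum>i<n. (x $ i)\<^sup>2) / r\<^sup>2"
      by (simp add: f_def power_divide sum_divide_distrib)
    also have "(\<Sum>i<n. (x $ i)\<^sup>2) = r\<^sup>2"
      unfolding r(2) using x by (simp add: scalar_prod_def power2_eq_square lessThan_atLeast0)
    finally have fK: "f \<in> K" using r(1) by (simp add: K_def f_def)
    have xf: "x = r \<cdot>\<^sub>v vec n f"
      using x r(1) by (auto simp: f_def)
    have "a / b * quad_form R (vec n f) \<le> a / b * b"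
      by (rule mult_left_mono) (use a(1) b fK in auto)
    also have "\<dots> \<le> quad_form Q (vec n f)"
      using a(2)[OF fK] b(1) by simp
    finally have "r\<^sup>2 * (a / b * quad_form R (vec n f)) \<le> r\<^sup>2 * quad_form Q (vec n f)"
      by (rule mult_left_mono) simp
    then show ?thesis
      by (simp only: xf quad_form_smult[OF R vec_carrier] quad_form_smult[OF Qc vec_carrier])
        (simp only: mult.left_commute)
  qed
  moreover have "a / b > 0" using a(1) b(1) by simp
  ultimately show thesis using that by blast
qed

text \<open>
  A single constant for a finite family is what makes the contraction along arcs uniform. The same
  statement yields the equivalence of the forms with the Euclidean norm and the bound on the growth
  of the norm under one letter. Keeping \<open>c \<le> 1\<close> makes \<open>1 - c\<close> a contraction factor and the
  powers of \<open>c\<close> decreasing.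
\<close>
lemma pos_def_family_dominates:
  assumes "finite S"
    and "\<And>s. s \<in> S \<Longrightarrow> pos_def_mat n (Q s)"
    and "\<And>s. s \<in> S \<Longrightarrow> R s \<in> carrier_mat n n"
    and nn: "\<And>s x. s \<in> S \<Longrightarrow> x \<in> carrier_vec n \<Longrightarrow> quad_form (R s) x \<ge> 0"
  obtains c where "0 < c" "c \<le> 1"
    "\<And>s x. s \<in> S \<Longrightarrow> x \<in> carrier_vec n \<Longrightarrow> c * quad_form (R s) x \<le> quad_form (Q s) x"
proof -
  have "\<forall>s\<in>S. \<exists>c>0. \<forall>x\<in>carrier_vec n. c * quad_form (R s) x \<le> quad_form (Q s) x"
    using assms(2,3) by (metis pos_def_dominates)
  then obtain C where C: "\<And>s. s \<in> S \<Longrightarrow> C s > 0"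
    "\<And>s x. s \<in> S \<Longrightarrow> x \<in> carrier_vec n \<Longrightarrow> C s * quad_form (R s) x \<le> quad_form (Q s) x"
    by metis
  define c where "c = Min (insert 1 (C ` S))"
  have "c > 0" using C(1) \<open>finite S\<close> by (simp add: c_def)
  moreover have "c \<le> 1" using \<open>finite S\<close> by (simp add: c_def)
  moreover have "c * quad_form (R s) x \<le> quad_form (Q s) x" if "s \<in> S" "x \<in> carrier_vec n" for s x
  proof -
    have "c \<le> C s" using that \<open>finite S\<close> by (simp add: c_def)
    then have "c * quad_form (R s) x \<le> C s * quad_form (R s) x"
      using nn[OF that] by (rule mult_right_mono)
    then show ?thesis using C(2)[OF that] by linarith
  qed
  ultimately show thesis using that by blast
qed

section \<open>The action of words and the splitting of blocks\<close>

text \<open>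
  The first letter of the word acts first. This is the order of time, and the reverse of the order
  in which \<open>word_mat\<close> multiplies.
\<close>
abbreviation word_act :: "(nat \<Rightarrow> real mat) \<Rightarrow> nat list \<Rightarrow> real vec \<Rightarrow> real vec" where
  "word_act A u x \<equiv> fold (\<lambda>a y. A a *\<^sub>v y) u x"

lemma trajectory_eq_word_act: "trajectory A \<sigma> x k = word_act A (map \<sigma> [0..<k]) x"
  by (induction k) auto

lemma word_mat_Cons: "word_mat n A (a # w) = A a * word_mat n A w"
  by (simp add: word_mat_def)

lemma word_mat_carrier:
  assumes "\<And>a. a \<in> set w \<Longrightarrow> A a \<in> carrier_mat n n"
  shows "word_mat n A w \<in> carrier_mat n n"
  using assms
proof (induction w)
  case Nil
  then show ?case by (simp add: word_mat_def)
next
  case (Cons a w)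
  then show ?case unfolding word_mat_Cons by (intro mult_carrier_mat) auto
qed

lemma word_mat_rev_mult_vec:
  assumes "\<And>a. a \<in> set u \<Longrightarrow> A a \<in> carrier_mat n n" "x \<in> carrier_vec n"
  shows "word_mat n A (rev u) *\<^sub>v x = word_act A u x"
  using assms(1)
proof (induction u rule: rev_induct)
  case Nil
  then show ?case using assms(2) by (simp add: word_mat_def)
next
  case (snoc a u)
  have "word_mat n A (rev u) \<in> carrier_mat n n"
    using snoc.prems by (intro word_mat_carrier) auto
  then have "word_mat n A (rev (u @ [a])) *\<^sub>v x = A a *\<^sub>v (word_mat n A (rev u) *\<^sub>v x)"
    using snoc.prems assms(2)
    by (simp add: word_mat_Cons assoc_mult_mat_vec[of "A a" n n "word_mat n A (rev u)" n])
  then show ?case using snoc by simp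
qed

lemma word_act_carrier:
  assumes "\<And>a. a \<in> set u \<Longrightarrow> A a \<in> carrier_mat n n" "x \<in> carrier_vec n"
  shows "word_act A u x \<in> carrier_vec n"
  using assms by (metis word_mat_rev_mult_vec word_mat_carrier mult_mat_vec_carrier set_rev)

text \<open>
  A word cut out of a concatenation of blocks consists of whole blocks, except for a piece of
  a block at either end. For a prefix there is such a piece only on the right.
\<close>
lemma prefix_concat_map:
  assumes "prefix v (concat (map f p))" "\<And>e. e \<in> set p \<Longrightarrow> length (f e) \<le> L"
  shows "\<exists>q t. v = concat (map f q) @ t \<and> prefix q p \<and> length t \<le> L"
  using assms
proof (induction p arbitrary: v)
  case Nil
  then show ?case by auto
next
  case (Cons e p)
  from Cons.prems(1) consider "prefix v (f e)"
    | v' where "v = f e @ v'" "prefix v' (concat (map f p))"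
    by (auto simp: prefix_append)
  then show ?case
  proof cases
    case 1
    then have "length v \<le> L" using Cons.prems(2)[of e] prefix_length_le[of v "f e"] by simp
    then show ?thesis by (intro exI[of _ "[]"] exI[of _ v]) auto
  next
    case 2
    then obtain q t where "v' = concat (map f q) @ t" "prefix q p" "length t \<le> L"
      using Cons.IH[of v'] Cons.prems(2) by auto
    then show ?thesis using 2 by (intro exI[of _ "e # q"] exI[of _ t]) auto
  qed
qed

lemma sublist_concat_map:
  assumes "sublist u (concat (map f p))" "\<And>e. e \<in> set p \<Longrightarrow> length (f e) \<le> L"
  shows "\<exists>s q t. u = s @ concat (map f q) @ t \<and> sublist q p \<and> length s \<le> L \<and> length t \<le> L"
  using assms
proof (induction p)
  case Nil
  then show ?case by auto
next
  case (Cons e p)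
  from Cons.prems(1) consider "sublist u (f e)" | "sublist u (concat (map f p))"
    | s v where "u = s @ v" "suffix s (f e)" "prefix v (concat (map f p))"
    by (auto simp: sublist_append)
  then show ?case
  proof cases
    case 1
    then have "length u \<le> L" using Cons.prems(2)[of e] sublist_length_le[of u "f e"] by simp
    then show ?thesis by (intro exI[of _ u] exI[of _ "[]"]) auto
  next
    case 2
    then show ?thesis using Cons.IH Cons.prems(2) by (force intro: sublist_Cons_right[THEN iffD2])
  next
    case 3
    then obtain q t where q: "v = concat (map f q) @ t" "prefix q p" "length t \<le> L"
      using prefix_concat_map[of v f p L] Cons.prems(2) by auto
    have "length s \<le> L" using Cons.prems(2)[of e] suffix_length_le[OF 3(2)] by simp
    moreover have "sublist q (e # p)"
      using q(2) by (simp add: sublist_Cons_right prefix_imp_sublist)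
    ultimately show ?thesis using 3(1) q by blast
  qed
qed

section \<open>Path-complete graphs imply stability\<close>

lemma word_act_growth:
  fixes A :: "nat \<Rightarrow> real mat"
  assumes carrier: "\<And>a. a \<in> {1..m} \<Longrightarrow> A a \<in> carrier_mat n n"
    and c: "0 < c" "\<And>a x. a \<in> {1..m} \<Longrightarrow> x \<in> carrier_vec n \<Longrightarrow> c * ((A a *\<^sub>v x) \<bullet> (A a *\<^sub>v x)) \<le> x \<bullet> x"
    and u: "u \<in> lists {1..m}" and x: "x \<in> carrier_vec n"
  shows "c ^ length u * (word_act A u x \<bullet> word_act A u x) \<le> x \<bullet> x"
  using u x
proof (induction u arbitrary: x rule: list.induct)
  case Nil
  then show ?case by simp
next
  case (Cons a u)
  let ?y = "A a *\<^sub>v x" and ?z = "word_act A (a # u) x"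
  have a: "a \<in> {1..m}" using Cons.prems by simp
  have y: "?y \<in> carrier_vec n" using carrier[OF a] Cons.prems(2) by (rule mult_mat_vec_carrier)
  have "c ^ length (a # u) * (?z \<bullet> ?z) = c * (c ^ length u * (word_act A u ?y \<bullet> word_act A u ?y))"
    by simp
  also have "\<dots> \<le> c * (?y \<bullet> ?y)"
    using Cons.IH[OF _ y] Cons.prems c(1) by (intro mult_left_mono) auto
  also have "\<dots> \<le> x \<bullet> x" using c(2)[OF a] Cons.prems by simp
  finally show ?case .
qed

text \<open>
  The incomplete arc labels at the two ends of a word are bounded in length but otherwise unknown, so
  the estimate for them must depend on the bound \<open>L\<close> only.
\<close>
lemma word_act_growth_bounded_length:
  fixes A :: "nat \<Rightarrow> real mat"
  assumes carrier: "\<And>a. a \<in> {1..m} \<Longrightarrow> A a \<in> carrier_mat n n"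
    and c: "0 < c" "c \<le> 1"
      "\<And>a x. a \<in> {1..m} \<Longrightarrow> x \<in> carrier_vec n \<Longrightarrow> c * ((A a *\<^sub>v x) \<bullet> (A a *\<^sub>v x)) \<le> x \<bullet> x"
    and u: "u \<in> lists {1..m}" "length u \<le> L" and x: "x \<in> carrier_vec n"
  shows "c ^ L * (word_act A u x \<bullet> word_act A u x) \<le> x \<bullet> x"
proof -
  have "c ^ L \<le> c ^ length u" using c(1,2) u(2) by (intro power_decreasing) auto
  then have "c ^ L * (word_act A u x \<bullet> word_act A u x)
      \<le> c ^ length u * (word_act A u x \<bullet> word_act A u x)"
    by (intro mult_right_mono scalar_prod_self_nonneg)
  then show ?thesis
    using word_act_growth[where A = A and m = m and n = n, OF carrier c(1,3) u(1) x] by linarith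
qed

text \<open>
  A word \<open>u\<close> splits into two end pieces of length at most \<open>L\<close> and the label of a walk \<open>q\<close>. The end
  pieces cost constant factors, the walk contracts by \<open>\<gamma> ^ length q\<close>, and \<open>q\<close> has at least
  \<open>length u div L - 2\<close> arcs. This bounds the norm of the state uniformly over all words of a given
  length, and the bound tends to zero.
\<close>
lemma path_complete_imp_sufficient:
  fixes G :: "('v, 'e) pre_digraph"
  assumes fin: "fin_digraph G"
    and lab: "\<And>e. e \<in> arcs G \<Longrightarrow> label e \<in> lists {1..m}"
    and pc: "path_complete m G label"
  shows "sufficient_for_stability m G label"
  unfolding sufficient_for_stability_def
proof (intro allI impI)
  fix n :: nat and A :: "nat \<Rightarrow> real mat"
  assume "\<forall>a\<in>{1..m}. A a \<in> carrier_mat n n"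
    and sat: "satisfies_ellipsoidal_inequalities G label n A"
  then have carrier: "A a \<in> carrier_mat n n" if "a \<in> {1..m}" for a using that by blast
  interpret fin_digraph G by (rule fin)
  let ?N = "\<lambda>x :: real vec. x \<bullet> x"
  define W where "W e = word_mat n A (rev (label e))" for e
  obtain P where P: "\<And>i. i \<in> verts G \<Longrightarrow> pos_def_mat n (P i)"
    and PW: "\<And>e. e \<in> arcs G \<Longrightarrow>
        pos_def_mat n (P (tail G e) - (W e)\<^sup>T * P (head G e) * W e)"
    using sat unfolding satisfies_ellipsoidal_inequalities_def W_def Let_def by blast
  have Pc: "P i \<in> carrier_mat n n" if "i \<in> verts G" for i
    using P[OF that] by (simp add: pos_def_mat_def)
  have lc: "A a \<in> carrier_mat n n" if "u \<in> lists {1..m}" "a \<in> set u" for u a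
    using that carrier by blast
  have act: "word_act A u x \<in> carrier_vec n" if "u \<in> lists {1..m}" "x \<in> carrier_vec n" for u x
    by (rule word_act_carrier[OF lc[OF that(1)] that(2)])
  have Wc: "W e \<in> carrier_mat n n" if "e \<in> arcs G" for e
    unfolding W_def by (rule word_mat_carrier) (use lc[OF lab[OF that]] in simp)
  have Wact: "W e *\<^sub>v x = word_act A (label e) x" if "e \<in> arcs G" "x \<in> carrier_vec n" for e x
    unfolding W_def by (rule word_mat_rev_mult_vec[OF lc[OF lab[OF that(1)]] that(2)])

  obtain \<delta> where \<delta>: "0 < \<delta>" "\<delta> \<le> 1" "\<And>e x. e \<in> arcs G \<Longrightarrow> x \<in> carrier_vec n \<Longrightarrow>
      \<delta> * quad_form (P (tail G e)) x
        \<le> quad_form (P (tail G e) - (W e)\<^sup>T * P (head G e) * W e) x"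
    by (rule pos_def_family_dominates[of "arcs G" n
          "\<lambda>e. P (tail G e) - (W e)\<^sup>T * P (head G e) * W e" "\<lambda>e. P (tail G e)"])
      (use PW Pc pos_def_quad_form_nonneg[OF P] in auto)
  obtain \<alpha> where \<alpha>: "0 < \<alpha>" "\<And>i x. i \<in> verts G \<Longrightarrow> x \<in> carrier_vec n \<Longrightarrow>
      \<alpha> * ?N x \<le> quad_form (P i) x"
    by (rule pos_def_family_dominates[of "verts G" n P "\<lambda>_. 1\<^sub>m n"])
      (use P scalar_prod_self_nonneg in auto)
  obtain \<beta> where \<beta>: "0 < \<beta>" "\<And>i x. i \<in> verts G \<Longrightarrow> x \<in> carrier_vec n \<Longrightarrow>
      \<beta> * quad_form (P i) x \<le> ?N x"
    by (rule pos_def_family_dominates[of "verts G" n "\<lambda>_. 1\<^sub>m n" P])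
      (use Pc pos_def_quad_form_nonneg[OF P] pos_def_one_mat in auto)
  (* The squared norm after one letter is the form of a Gram matrix, so the comparison of forms
     also bounds the growth of the norm. *)
  have gram: "quad_form ((A a)\<^sup>T * 1\<^sub>m n * A a) x = ?N (A a *\<^sub>v x)"
    if "a \<in> {1..m}" "x \<in> carrier_vec n" for a x
    using carrier[OF that(1)] that(2)
    by (simp only: quad_form_congruence[of "1\<^sub>m n" n "A a" x] one_carrier_mat
        quad_form_one[of _ n] mult_mat_vec_carrier[of _ n n])
  obtain c where c: "0 < c" "c \<le> 1" "\<And>a x. a \<in> {1..m} \<Longrightarrow> x \<in> carrier_vec n \<Longrightarrow>
      c * ?N (A a *\<^sub>v x) \<le> ?N x"
  proof (rule pos_def_family_dominates[of "{1..m}" n "\<lambda>_. 1\<^sub>m n" "\<lambda>a. (A a)\<^sup>T * 1\<^sub>m n * A a"])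
    fix a and x :: "real vec" assume ax: "a \<in> {1..m}" "x \<in> carrier_vec n"
    show "quad_form ((A a)\<^sup>T * 1\<^sub>m n * A a) x \<ge> 0"
      unfolding gram[OF ax] by (rule scalar_prod_self_nonneg)
  next
    fix c assume "0 < c" "c \<le> 1" and
      *: "\<And>a x. a \<in> {1..m} \<Longrightarrow> x \<in> carrier_vec n \<Longrightarrow>
         c * quad_form ((A a)\<^sup>T * 1\<^sub>m n * A a) x \<le> quad_form (1\<^sub>m n) x"
    then show thesis using that[of c] by (simp add: gram del: atLeastAtMost_iff)
  next
    fix a assume "a \<in> {1..m}"
    then show "(A a)\<^sup>T * 1\<^sub>m n * A a \<in> carrier_mat n n"
      by (intro congruence_carrier one_carrier_mat carrier)
  qed (use pos_def_one_mat in auto)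

  define \<gamma> where "\<gamma> = 1 - \<delta>"
  have \<gamma>: "0 \<le> \<gamma>" "\<gamma> < 1" using \<delta> by (auto simp: \<gamma>_def)
  have contract: "quad_form (P (head G e)) (word_act A (label e) x) \<le> \<gamma> * quad_form (P (tail G e)) x"
    if e: "e \<in> arcs G" and x: "x \<in> carrier_vec n" for e x
  proof -
    have "quad_form (P (tail G e) - (W e)\<^sup>T * P (head G e) * W e) x
      = quad_form (P (tail G e)) x - quad_form ((W e)\<^sup>T * P (head G e) * W e) x"
      using e x Pc Wc by (intro quad_form_diff[of _ n] congruence_carrier) auto
    also have "quad_form ((W e)\<^sup>T * P (head G e) * W e) x = quad_form (P (head G e)) (W e *\<^sub>v x)"
      using e x Pc Wc by (intro quad_form_congruence[of _ n]) auto
    finally show ?thesis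
      using \<delta>(3)[OF e x] Wact[OF e x] by (simp add: \<gamma>_def algebra_simps)
  qed
  have walk: "quad_form (P j) (word_act A (concat (map label q)) x) \<le> \<gamma> ^ length q * quad_form (P i) x"
    if "awalk i q j" "x \<in> carrier_vec n" for i q j x
    using that
  proof (induction q arbitrary: i x)
    case Nil
    then show ?case by (simp add: awalk_Nil_iff)
  next
    case (Cons e q)
    then have e: "e \<in> arcs G" "i = tail G e" "awalk (head G e) q j"
      by (auto simp: awalk_Cons_iff)
    let ?y = "word_act A (label e) x"
    have y: "?y \<in> carrier_vec n" by (rule act[OF lab[OF e(1)] Cons.prems(2)])
    have "quad_form (P j) (word_act A (concat (map label q)) ?y)
        \<le> \<gamma> ^ length q * quad_form (P (head G e)) ?y"
      by (rule Cons.IH[OF e(3) y])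
    also have "\<dots> \<le> \<gamma> ^ length q * (\<gamma> * quad_form (P i) x)"
      unfolding e(2) by (intro mult_left_mono contract e Cons.prems) (use \<gamma> in simp)
    finally show ?case by (simp add: mult_ac)
  qed

  (* The graph may have no arcs; the inserted 0 gives Max a value, and Suc makes L a divisor. *)
  define L where "L = Suc (Max (insert 0 ((length \<circ> label) ` arcs G)))"
  have L: "length (label e) \<le> L" if "e \<in> arcs G" for e
  proof -
    have "(length \<circ> label) e \<le> Max (insert 0 ((length \<circ> label) ` arcs G))"
      using that finite_arcs by (intro Max_ge) auto
    then show ?thesis by (simp add: L_def)
  qed
  define D where "D = c ^ L * \<alpha> * \<beta> * c ^ L"
  have D: "D > 0" using c \<alpha> \<beta> by (simp add: D_def)
  have decay: "D * ?N (word_act A u x) \<le> \<gamma> ^ (length u div L - 2) * ?N x"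
    if u: "u \<in> lists {1..m}" and x: "x \<in> carrier_vec n" for u x
  proof -
    obtain i p j where p: "awalk i p j" "sublist u (concat (map label p))"
      using pc u unfolding path_complete_def by blast
    have pa: "set p \<subseteq> arcs G" using p(1) by blast
    obtain s q t where sqt: "u = s @ concat (map label q) @ t" "sublist q p"
      "length s \<le> L" "length t \<le> L"
      using sublist_concat_map[OF p(2), of L] L pa by blast
    obtain p1 p2 where "p = p1 @ q @ p2" using sqt(2) by (auto simp: sublist_def)
    then obtain i' j' where q: "awalk i' q j'"
      using p(1) by (auto simp: awalk_append_iff)
    have ij: "i' \<in> verts G" "j' \<in> verts G" using q by (auto simp: awalk_hd_in_verts awalk_last_in_verts)
    have qa: "set q \<subseteq> arcs G" using q by blast
    define x1 where "x1 = word_act A s x"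
    define x2 where "x2 = word_act A (concat (map label q)) x1"
    have st: "s \<in> lists {1..m}" "concat (map label q) \<in> lists {1..m}" "t \<in> lists {1..m}"
      using u unfolding sqt(1) by auto
    have x1: "x1 \<in> carrier_vec n" unfolding x1_def by (rule act[OF st(1) x])
    have x2: "x2 \<in> carrier_vec n" unfolding x2_def by (rule act[OF st(2) x1])
    have y: "word_act A u x = word_act A t x2" by (simp add: sqt(1) x1_def x2_def)
    have "length (concat (map label q)) \<le> L * length q"
      using qa by (induction q) (use L in \<open>auto simp: add_mono\<close>)
    then have "length u \<le> (length q + 2) * L"
      using sqt(3,4) by (simp add: sqt(1) algebra_simps)
    then have "length u div L \<le> length q + 2"
      by (metis L_def div_le_mono nonzero_mult_div_cancel_right nat.distinct(1))
    then have exps: "\<gamma> ^ length q \<le> \<gamma> ^ (length u div L - 2)"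
      using \<gamma> by (intro power_decreasing) auto
    have "D * ?N (word_act A u x) = c ^ L * \<beta> * (\<alpha> * (c ^ L * ?N (word_act A t x2)))"
      by (simp add: D_def y)
    also have "\<dots> \<le> c ^ L * \<beta> * (\<alpha> * ?N x2)"
      using c(1) \<alpha>(1) \<beta>(1)
      by (intro mult_left_mono word_act_growth_bounded_length[where A = A and m = m and n = n, OF carrier c st(3) sqt(4) x2]) auto
    also have "\<dots> \<le> c ^ L * \<beta> * quad_form (P j') x2"
      using c(1) \<beta>(1) by (intro mult_left_mono \<alpha>(2) ij x2) auto
    also have "\<dots> \<le> c ^ L * \<beta> * (\<gamma> ^ length q * quad_form (P i') x1)"
      unfolding x2_def using c(1) \<beta>(1) by (intro mult_left_mono walk[OF q x1]) auto
    also have "\<dots> = \<gamma> ^ length q * c ^ L * (\<beta> * quad_form (P i') x1)" by simp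
    also have "\<dots> \<le> \<gamma> ^ length q * c ^ L * ?N x1"
      using c(1) \<gamma>(1) by (intro mult_left_mono \<beta>(2) ij x1) auto
    also have "\<dots> = \<gamma> ^ length q * (c ^ L * ?N x1)" by simp
    also have "\<dots> \<le> \<gamma> ^ length q * ?N x"
      unfolding x1_def using \<gamma>(1)
      by (intro mult_left_mono word_act_growth_bounded_length[where A = A and m = m and n = n, OF carrier c st(1) sqt(3) x]) auto
    also have "\<dots> \<le> \<gamma> ^ (length u div L - 2) * ?N x"
      by (intro mult_right_mono exps scalar_prod_self_nonneg)
    finally show ?thesis .
  qed

  show "stable_set m n A"
    unfolding stable_set_def
  proof (intro allI impI ballI)
    fix \<sigma> :: "nat \<Rightarrow> nat" and x :: "real vec"
    assume \<sigma>: "\<forall>k. \<sigma> k \<in> {1..m}" and x: "x \<in> carrier_vec n"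
    let ?f = "\<lambda>k. ?N (trajectory A \<sigma> x k)"
    have bound: "?f k \<le> \<gamma> ^ (k div L - 2) * ?N x / D" for k
    proof -
      have "map \<sigma> [0..<k] \<in> lists {1..m}" using \<sigma> by auto
      from decay[OF this x] show ?thesis
        using D by (simp add: trajectory_eq_word_act pos_le_divide_eq mult.commute)
    qed
    have "filterlim (\<lambda>k. k div L - 2) at_top sequentially"
      unfolding filterlim_at_top
    proof
      fix Z
      have "Z \<le> k div L - 2" if "k \<ge> (Z + 2) * L" for k
      proof -
        have "L > 0" by (simp add: L_def)
        then show ?thesis using div_le_mono[OF that, of L] by simp
      qed
      then show "\<forall>\<^sub>F k in sequentially. Z \<le> k div L - 2"
        unfolding eventually_sequentially by blast
    qed
    then have "(\<lambda>k. \<gamma> ^ (k div L - 2)) \<longlonglongrightarrow> 0"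
      by (rule filterlim_compose[OF LIMSEQ_realpow_zero[OF \<gamma>]])
    then have "(\<lambda>k. \<gamma> ^ (k div L - 2) * (?N x / D)) \<longlonglongrightarrow> 0"
      by (rule tendsto_mult_left_zero)
    then have "?f \<longlonglongrightarrow> 0"
      by (rule tendsto_sandwich[of "\<lambda>_. 0", rotated 3])
        (use bound scalar_prod_self_nonneg in auto)
    then show "(\<lambda>k. sqrt (?f k)) \<longlonglongrightarrow> 0"
      using tendsto_real_sqrt[of ?f 0] by simp
  qed
qed

section \<open>Cyclic shift matrices of a word\<close>

text \<open>The word \<open>u\<close> is a block of \<open>www\<dots>\<close> starting at position \<open>k\<close>.\<close>
definition cyc_reads :: "nat list \<Rightarrow> nat list \<Rightarrow> nat \<Rightarrow> bool" where
  "cyc_reads w u k \<longleftrightarrow> (\<forall>t<length u. u ! t = w ! ((k + t) mod length w))"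

lemma cyc_reads_append:
  "cyc_reads w (u @ v) k \<longleftrightarrow> cyc_reads w u k \<and> cyc_reads w v ((k + length u) mod length w)"
proof
  assume "cyc_reads w (u @ v) k"
  then have *: "(u @ v) ! t = w ! ((k + t) mod length w)" if "t < length (u @ v)" for t
    using that unfolding cyc_reads_def by blast
  have "u ! t = w ! ((k + t) mod length w)" if "t < length u" for t
    using *[of t] that by (simp add: nth_append)
  moreover have "v ! t = w ! (((k + length u) mod length w + t) mod length w)" if "t < length v" for t
    using *[of "length u + t"] that by (simp add: mod_add_left_eq add.assoc)
  ultimately show "cyc_reads w u k \<and> cyc_reads w v ((k + length u) mod length w)"
    by (simp add: cyc_reads_def)
next
  assume uv: "cyc_reads w u k \<and> cyc_reads w v ((k + length u) mod length w)"
  have "(u @ v) ! t = w ! ((k + t) mod length w)" if "t < length (u @ v)" for t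
  proof (cases "t < length u")
    case True
    then show ?thesis using uv by (simp add: nth_append cyc_reads_def)
  next
    case False
    then obtain s where s: "t = length u + s" by (metis le_Suc_ex not_less)
    then have "v ! s = w ! (((k + length u) mod length w + s) mod length w)"
      using uv that by (simp add: cyc_reads_def)
    then show ?thesis by (simp add: s mod_add_left_eq add.assoc)
  qed
  then show "cyc_reads w (u @ v) k" by (simp add: cyc_reads_def)
qed

text \<open>
  At most one turn brings the reading back to position \<open>0\<close>, and the next full turn reads \<open>w\<close>.
\<close>
lemma cyc_reads_sublist:
  assumes "cyc_reads w u k" "k < length w" "length u \<ge> 2 * length w"
  shows "sublist w u"
proof -
  let ?n = "length w"
  have "w ! i = u ! (?n - k + i)" if "i < ?n" for i
  proof -
    have "u ! (?n - k + i) = w ! ((k + (?n - k + i)) mod ?n)"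
      using assms that by (auto simp: cyc_reads_def)
    then show ?thesis using assms(2) that by simp
  qed
  then have "w = take ?n (drop (?n - k) u)"
    using assms by (intro nth_equalityI) auto
  then show ?thesis by (metis sublist_take sublist_drop sublist_order.order_trans)
qed

text \<open>
  Column \<open>c\<close> is the unit vector of the position after \<open>c\<close> on the cycle if \<open>a\<close> is the letter at \<open>c\<close>,
  and zero otherwise.
\<close>
definition cyc_shift :: "nat list \<Rightarrow> nat \<Rightarrow> real mat" where
  "cyc_shift w a = mat (length w) (length w)
     (\<lambda>(r, c). if w ! c = a \<and> r = Suc c mod length w then 1 else 0)"

lemma cyc_shift_carrier: "cyc_shift w a \<in> carrier_mat (length w) (length w)"
  by (simp add: cyc_shift_def)

lemma word_mat_cyc_shift:
  "word_mat (length w) (cyc_shift w) (rev u) = mat (length w) (length w)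
     (\<lambda>(r, c). if cyc_reads w u c \<and> r = (c + length u) mod length w then 1 else 0)"
proof (induction u rule: rev_induct)
  case Nil
  show ?case by (auto simp: word_mat_def cyc_reads_def)
next
  case (snoc a u)
  let ?n = "length w"
  have "(cyc_shift w a * word_mat ?n (cyc_shift w) (rev u)) $$ (r, c)
    = (if cyc_reads w (u @ [a]) c \<and> r = (c + length (u @ [a])) mod ?n then 1 else 0)"
    if rc: "r < ?n" "c < ?n" for r c
  proof -
    let ?d = "(c + length u) mod ?n"
    have d: "?d < ?n" using rc by (intro mod_less_divisor) linarith
    have "(cyc_shift w a * word_mat ?n (cyc_shift w) (rev u)) $$ (r, c)
      = (\<Sum>k = 0..<?n. (if w ! k = a \<and> r = Suc k mod ?n then 1 else 0) *
           (if cyc_reads w u c \<and> k = ?d then 1 else 0))"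
      unfolding snoc.IH using rc by (simp add: cyc_shift_def scalar_prod_def)
    also have "\<dots> = (\<Sum>k = 0..<?n. if k = ?d then
        (if w ! ?d = a \<and> r = Suc ?d mod ?n \<and> cyc_reads w u c then 1 else 0) else 0)"
      by (intro sum.cong) auto
    also have "\<dots> = (if w ! ?d = a \<and> r = Suc ?d mod ?n \<and> cyc_reads w u c then 1 else 0)"
      using d by simp
    finally show ?thesis
      by (auto simp: cyc_reads_append mod_simps cyc_reads_def[of w "[a]"])
  qed
  then show ?case
    by (simp add: word_mat_Cons) (rule eq_matI, auto simp: cyc_shift_def snoc.IH)
qed

lemma pos_def_mat_diag:
  assumes "\<And>k. k < n \<Longrightarrow> f k > 0"
  shows "pos_def_mat n (mat_diag n f)"
proof -
  have "x \<bullet> (mat_diag n f *\<^sub>v x) > 0" if x: "x \<in> carrier_vec n" "x \<noteq> 0\<^sub>v n" for x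
  proof -
    obtain i where i: "i < n" "x $ i \<noteq> 0"
      using x by (metis carrier_vecD eq_vecI index_zero_vec(1,2))
    have row: "(mat_diag n f *\<^sub>v x) $ k = f k * x $ k" if "k < n" for k
      using that x by (simp add: mat_diag_def scalar_prod_def if_distrib[of "\<lambda>z. z * _"] cong: if_cong)
    have "x \<bullet> (mat_diag n f *\<^sub>v x) = (\<Sum>k = 0..<n. f k * (x $ k)\<^sup>2)"
      using x row by (auto simp: scalar_prod_def mat_diag_def power2_eq_square intro!: sum.cong)
    also have "\<dots> > 0"
      using i assms by (intro sum_pos2[of _ i]) (auto simp: less_imp_le)
    finally show ?thesis .
  qed
  then show ?thesis
    by (auto simp: pos_def_mat_def mat_diag_def)
qed

text \<open>
  Every word moves distinct positions to distinct positions or kills them. Hence congruence by its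
  matrix keeps diagonal matrices diagonal, and the Lyapunov inequalities for diagonal
  unknowns become scalar inequalities, one for each position.
\<close>
lemma cyc_shift_congruence:
  fixes w u :: "nat list"
  defines "n \<equiv> length w" and "W \<equiv> word_mat (length w) (cyc_shift w) (rev u)"
  shows "W\<^sup>T * mat_diag n f * W
    = mat_diag n (\<lambda>k. if cyc_reads w u k then f ((k + length u) mod n) else 0)"
proof -
  have W: "W = mat n n (\<lambda>(r, c). if cyc_reads w u c \<and> r = (c + length u) mod n then 1 else 0)"
    by (simp add: W_def n_def word_mat_cyc_shift)
  have inj: "c = d" if "(c + length u) mod n = (d + length u) mod n" "c < n" "d < n" for c d
    using that by (metis cong_add_rcancel_nat mod_less unique_euclidean_semiring_class.cong_def)
  have Wc: "W \<in> carrier_mat n n" by (simp add: W)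
  have "(W\<^sup>T * mat_diag n f * W) $$ (r, c)
    = (if r = c then if cyc_reads w u c then f ((c + length u) mod n) else 0 else 0)"
    if rc: "r < n" "c < n" for r c
  proof -
    let ?d = "(c + length u) mod n"
    have d: "?d < n" using rc by (intro mod_less_divisor) linarith
    have "(W\<^sup>T * mat_diag n f * W) $$ (r, c) = (\<Sum>k = 0..<n. W $$ (k, r) * f k * W $$ (k, c))"
      using rc Wc by (subst mat_diag_mult_right[of _ n n]) (auto simp: scalar_prod_def)
    also have "\<dots> = (\<Sum>k = 0..<n. if k = ?d then
        (if cyc_reads w u r \<and> cyc_reads w u c \<and> (r + length u) mod n = ?d then f ?d else 0) else 0)"
      using rc by (intro sum.cong) (auto simp: W)
    also have "\<dots> = (if cyc_reads w u r \<and> cyc_reads w u c \<and> (r + length u) mod n = ?d then f ?d else 0)"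
      using d by simp
    finally show ?thesis using inj[of r c] rc by auto
  qed
  then show ?thesis
    using Wc by (intro eq_matI) (auto simp: mat_diag_def)
qed

lemma not_stable_cyc_shift:
  assumes w: "w \<noteq> []" "w \<in> lists {1..m}"
  shows "\<not> stable_set m (length w) (cyc_shift w)"
proof
  let ?n = "length w"
  let ?s = "\<lambda>k. w ! (k mod ?n)"
  let ?e = "unit_vec ?n 0 :: real vec"
  have n: "?n > 0" using w by simp
  have step: "cyc_shift w (w ! c) *\<^sub>v unit_vec ?n c = unit_vec ?n (Suc c mod ?n)" if "c < ?n" for c
  proof -
    have "Suc c mod ?n < ?n" using n by simp
    then show ?thesis using that by (intro eq_vecI) (auto simp: cyc_shift_def)
  qed
  have "trajectory (cyc_shift w) ?s ?e k = unit_vec ?n (k mod ?n)" for k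
    using n by (induction k) (simp_all add: step mod_Suc_eq)
  then have one: "sqrt (trajectory (cyc_shift w) ?s ?e k \<bullet> trajectory (cyc_shift w) ?s ?e k) = 1" for k
    using n by simp
  assume "stable_set m ?n (cyc_shift w)"
  moreover have "\<forall>k. ?s k \<in> {1..m}" using w n by (auto simp del: atLeastAtMost_iff)
  ultimately have "(\<lambda>k. sqrt (trajectory (cyc_shift w) ?s ?e k \<bullet> trajectory (cyc_shift w) ?s ?e k)) \<longlonglongrightarrow> 0"
    unfolding stable_set_def by (metis unit_vec_carrier)
  then show False unfolding one by (simp add: LIMSEQ_const_iff)
qed

section \<open>A word contained in no walk\<close>

text \<open>
  The length of a longest readable walk plays the role of a Lyapunov function: after traversing an arc
  that can be read, the longest continuation is shorter by at least one arc; an arc that cannot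
  be read maps the unit vector to zero. The \<open>Suc\<close> in \<open>d\<close> keeps the diagonal entries positive where no arc
  can be read.
\<close>
lemma unread_word_refutes_sufficiency:
  fixes G :: "('v, 'e) pre_digraph"
  assumes fin: "fin_digraph G"
    and lab: "\<And>e. e \<in> arcs G \<Longrightarrow> label e \<noteq> []"
    and w: "w \<noteq> []" "w \<in> lists {1..m}"
    and unread: "\<And>i p j. pre_digraph.awalk G i p j \<Longrightarrow> \<not> sublist w (concat (map label p))"
  shows "\<not> sufficient_for_stability m G label"
proof -
  interpret fin_digraph G by (rule fin)
  let ?n = "length w"
  have n: "?n \<ge> 1" using w(1) by (simp add: Suc_le_eq)
  define S where "S i k = {length p | p j. awalk i p j \<and> cyc_reads w (concat (map label p)) k}" for i k
  define d where "d i k = Suc (Max (S i k))" for i k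
  have bound: "S i k \<subseteq> {..<2 * ?n}" if "k < ?n" for i k
  proof
    fix l assume "l \<in> S i k"
    then obtain p j where p: "l = length p" "awalk i p j" "cyc_reads w (concat (map label p)) k"
      by (auto simp: S_def)
    have "set p \<subseteq> arcs G" using p(2) by blast
    then have "length p \<le> length (concat (map label p))"
    proof (induction p)
      case (Cons e p)
      then have "label e \<noteq> []" using lab[of e] by simp
      then show ?case using Cons by (cases "label e") auto
    qed simp
    moreover have "length (concat (map label p)) < 2 * ?n"
      using cyc_reads_sublist[OF p(3) that] unread[OF p(2)] by linarith
    ultimately show "l \<in> {..<2 * ?n}" using p(1) by simp
  qed
  have finS: "finite (S i k)" if "k < ?n" for i k
    using bound[OF that] finite_subset by blast
  have zero: "0 \<in> S i k" if "i \<in> verts G" for i k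
    using that unfolding S_def by (intro CollectI exI[of _ "[]"]) (auto simp: awalk_Nil_iff cyc_reads_def)
  have decrease: "d (head G e) ((k + length (label e)) mod ?n) < d (tail G e) k"
    if e: "e \<in> arcs G" and k: "k < ?n" and r: "cyc_reads w (label e) k" for e k
  proof -
    let ?k = "(k + length (label e)) mod ?n"
    have k': "?k < ?n" using w(1) by simp
    have "Max (S (head G e) ?k) \<in> S (head G e) ?k"
      using finS[OF k'] zero[of "head G e" ?k] e by (intro Max_in) auto
    then obtain p j where p: "Max (S (head G e) ?k) = length p" "awalk (head G e) p j"
      "cyc_reads w (concat (map label p)) ?k"
      by (auto simp: S_def)
    have "length (e # p) \<in> S (tail G e) k"
      unfolding S_def using e p r
      by (intro CollectI exI[of _ "e # p"] exI[of _ j]) (simp add: awalk_Cons_iff cyc_reads_append)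
    then have "Suc (length p) \<le> Max (S (tail G e) k)"
      using finS[OF k] by (auto intro: Max_ge)
    then show ?thesis using p(1) by (simp add: d_def)
  qed
  have "satisfies_ellipsoidal_inequalities G label ?n (cyc_shift w)"
    unfolding satisfies_ellipsoidal_inequalities_def Let_def
  proof (intro exI conjI ballI)
    fix i show "pos_def_mat ?n (mat_diag ?n (\<lambda>k. real (d i k)))"
      by (rule pos_def_mat_diag) (simp add: d_def)
  next
    fix e assume e: "e \<in> arcs G"
    define g where "g k = (if cyc_reads w (label e) k
      then real (d (head G e) ((k + length (label e)) mod ?n)) else 0)" for k
    let ?W = "word_mat ?n (cyc_shift w) (rev (label e))"
    have "mat_diag ?n (\<lambda>k. real (d (tail G e) k)) - ?W\<^sup>T * mat_diag ?n (\<lambda>k. real (d (head G e) k)) * ?W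
      = mat_diag ?n (\<lambda>k. real (d (tail G e) k) - g k)"
      unfolding cyc_shift_congruence g_def by (rule eq_matI) (auto simp: mat_diag_def)
    moreover have "g k < real (d (tail G e) k)" if "k < ?n" for k
      using decrease[OF e that] by (simp add: g_def d_def)
    ultimately show "pos_def_mat ?n (mat_diag ?n (\<lambda>k. real (d (tail G e) k))
        - ?W\<^sup>T * mat_diag ?n (\<lambda>k. real (d (head G e) k)) * ?W)"
      by (simp add: pos_def_mat_diag)
  qed
  then show ?thesis
    using n not_stable_cyc_shift[OF w] cyc_shift_carrier
    unfolding sufficient_for_stability_def by blast
qed

section \<open>The characterization\<close>

theorem theorem6:
  fixes m :: nat
    and G :: "('v, 'e) pre_digraph"
    and label :: "'e \<Rightarrow> nat list"
  assumes "m \<ge> 1"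
    and "fin_digraph G"
    and "\<And>e. e \<in> arcs G \<Longrightarrow> label e \<noteq> [] \<and> label e \<in> lists {1..m}"
  shows "sufficient_for_stability m G label \<longleftrightarrow> path_complete m G label"
proof
  assume suff: "sufficient_for_stability m G label"
  show "path_complete m G label"
  proof (rule ccontr)
    assume "\<not> path_complete m G label"
    then obtain u where u: "u \<in> lists {1..m}"
      "\<And>i p j. pre_digraph.awalk G i p j \<Longrightarrow> \<not> sublist u (concat (map label p))"
      unfolding path_complete_def by blast
    (* The word u may be empty; appending a letter gives a nonempty word that no walk contains. *)
    have "sublist u (u @ [1])" by simp
    then have "\<not> sublist (u @ [1]) (concat (map label p))" if "pre_digraph.awalk G i p j" for i p j
      using u(2)[OF that] sublist_order.order_trans by blast
    moreover have "u @ [1] \<in> lists {1..m}" using u(1) assms(1) by simp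
    ultimately have "\<not> sufficient_for_stability m G label"
      using assms by (intro unread_word_refutes_sufficiency[of G label "u @ [1]"]) auto
    then show False using suff by contradiction
  qed
next
  assume "path_complete m G label"
  then show "sufficient_for_stability m G label"
    using assms by (intro path_complete_imp_sufficient) auto
qed

end
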